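(* Let $f_1,\dots,f_m:\mathbb{R}^n\to\mathbb{R}$ be locally Lipschitz functions and $g_1,\dots,g_l:\mathbb{R}^n\to\mathbb{R}$ be convex functions, and consider the problem (MOP) of minimizing $f=(f_1,\dots,f_m)$ over $X=\{x\in\mathbb{R}^n: g_r(x)\le 0,\ r=1,\dots,l\}$. Assume that the Slater constraint qualification holds. Let $x_0$ be a local weak Pareto minimum of MOP and let $\{\varepsilon_k\}$ be a decreasing sequence of positive real numbers converging to $0$. Then there exists a sequence $\{x^k\}$ of feasible points converging to $x_0$ which has a subsequence $\{y^k\}$ such that for each $y^k$ there exists $\hat y^k$ satisfying: 1. $\|y^k-\hat y^k\|\le\sqrt{\varepsilon_k}$; 2. there exist $u_i^k\in\partial^\circ f_i(\hat y^k)$ for $i=1,\dots,m$, $v_r^k\in\partial^\circ g_r(\hat y^k)$ for $r=1,\dots,l$, $\lambda^k\in\mathbb{R}^m_+$ with $\|\lambda^k\|=1$, and $\mu^k\in\mathbb{R}^l_+$ such that $$\Big\|\sum_{i=1}^m\lambda_i^ku_i^k+\sum_{r=1}^l\mu_r^kv_r^k\Big\|\le\sqrt{\varepsilon_k}\quad\text{and}\quad\sum_{r=1}^l\mu_r^kg_r(\hat y^k)=0.$$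
   Context: Notation: $\|\cdot\|$ is the Euclidean norm, $\mathbb{R}^p_+$ is the nonnegative orthant, and $\partial^\circ h(x)$ is the Clarke subdifferential of a locally Lipschitz function $h:\mathbb{R}^n\to\mathbb{R}$ at $x$: $\partial^\circ h(x)=\{\xi\in\mathbb{R}^n: h^\circ(x,d)\ge\langle \xi,d\rangle\ \text{for all } d\in\mathbb{R}^n\}$, where $h^\circ(x,d)=\limsup_{y\to x,\,t\downarrow 0}\frac{h(y+td)-h(y)}{t}$ (for convex $h$ it coincides with the convex subdifferential). Slater constraint qualification: there exists $\hat x\in X$ with $g_r(\hat x)<0$ for all $r=1,\dots,l$. Local weak Pareto minimum: a point $x_0\in X$ for which there exists $\delta>0$ such that there is no $x\in X\cap B_\delta(x_0)$ with $f(x)-f(x_0)\in-\mathrm{int}(\mathbb{R}^m_+)$, where $B_\delta(x_0)$ is the ball of radius $\delta$ centered at $x_0$. *)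

theory Defs
  imports "HOL-Analysis.Analysis"
begin

(* The library's local_lipschitz is stated for families of functions depending on a
   parameter; a single function is the case of a family that ignores its parameter. *)
definition locally_lipschitz :: "('a::metric_space \<Rightarrow> 'b::metric_space) \<Rightarrow> bool" where
  "locally_lipschitz h \<longleftrightarrow> local_lipschitz (UNIV :: real set) UNIV (\<lambda>_. h)"

(* The base point y ranges over full neighbourhoods of x (y = x allowed), the step t over
   positive reals. The limsup lives in ereal, so no boundedness is presupposed. *)
definition clarke_dderiv :: "('a::real_normed_vector \<Rightarrow> real) \<Rightarrow> 'a \<Rightarrow> 'a \<Rightarrow> ereal" where
  "clarke_dderiv h x d =
     Limsup (nhds x \<times>\<^sub>F at_right (0::real)) (\<lambda>(y, t). ereal ((h (y + t *\<^sub>R d) - h y) / t))"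

definition clarke_subdiff :: "('a::real_inner \<Rightarrow> real) \<Rightarrow> 'a \<Rightarrow> 'a set" where
  "clarke_subdiff h x = {\<xi>. \<forall>d. clarke_dderiv h x d \<ge> ereal (\<xi> \<bullet> d)}"

definition nonneg_orthant :: "(real ^ 'p) set" where
  "nonneg_orthant = {z. \<forall>i. 0 \<le> z $ i}"

definition feasible_set :: "('l \<Rightarrow> 'a \<Rightarrow> real) \<Rightarrow> 'a set" where
  "feasible_set g = {x. \<forall>r. g r x \<le> 0}"

definition slater_cq :: "('l \<Rightarrow> 'a \<Rightarrow> real) \<Rightarrow> bool" where
  "slater_cq g \<longleftrightarrow> (\<exists>xh \<in> feasible_set g. \<forall>r. g r xh < 0)"

definition local_weak_pareto_min ::
  "('m::finite \<Rightarrow> 'a::metric_space \<Rightarrow> real) \<Rightarrow> 'a set \<Rightarrow> 'a \<Rightarrow> bool" where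
  "local_weak_pareto_min f X x0 \<longleftrightarrow>
     x0 \<in> X \<and>
     (\<exists>\<delta>>0. \<not> (\<exists>x \<in> X \<inter> ball x0 \<delta>.
        (\<chi> i. f i x) - (\<chi> i. f i x0) \<in> uminus ` interior (nonneg_orthant :: (real ^ 'm) set)))"

end

theory Submission
  imports Defs
begin

text \<open>
  The point \<open>x0\<close> itself satisfies the multiplier rule exactly, so constant sequences suffice.
  Write \<open>P\<^sub>i d\<close> for the Clarke directional derivative of \<open>f i\<close> at \<open>x0\<close>; for locally Lipschitz \<open>f i\<close> it
  is a finite convex function of \<open>d\<close> with \<open>P\<^sub>i 0 = 0\<close>. The system
  \<open>P\<^sub>i (y - x0) < 0\<close> for all \<open>i\<close>, \<open>g r y < 0\<close> for all \<open>r\<close> has no solution \<open>y\<close>: moving from \<open>x0\<close> a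
  short way towards \<open>y\<close> would lower every objective, and by convexity of the constraints would stay
  feasible, against local weak Pareto minimality.

  An unsolvable system of convex inequalities has nonnegative multipliers, not all zero
  (\<open>convex_alternative\<close>): \<open>\<Sum>\<lambda>\<^sub>i P\<^sub>i (y - x0) + \<Sum>\<mu>\<^sub>r g r y \<ge> 0\<close> for every \<open>y\<close>. At \<open>y = x0\<close> every term is
  \<open>\<le> 0\<close>, which gives complementarity and shows that \<open>x0\<close> minimizes the convex function on the left. A
  Slater point excludes \<open>\<lambda> = 0\<close>, so \<open>\<lambda>\<close> can be normalized. The sum rule for convex functions
  (\<open>subgradients_weighted_sum\<close>) splits \<open>0\<close> into subgradients of the summands, and these are Clarke
  subgradients: for \<open>P\<^sub>i\<close> at \<open>0\<close> by the definition of the Clarke subdifferential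
  (\<open>subgradient_clarke_model\<close>), for \<open>g r\<close> because a difference quotient based at \<open>x0\<close> bounds the
  Clarke derivative from below (\<open>subgradients_subset_clarke\<close>). Thus the Clarke calculus for sums
  and maxima is replaced by convex analysis of the directional derivatives.
\<close>

section \<open>Subgradients of finite convex functions\<close>

definition subgradients :: "('a::real_inner \<Rightarrow> real) \<Rightarrow> 'a \<Rightarrow> 'a set" where
  "subgradients h x = {v. \<forall>y. h x + v \<bullet> (y - x) \<le> h y}"

lemma inner_self_nonpos: "v \<bullet> v \<le> 0 \<Longrightarrow> v = 0"
  by (metis inner_ge_zero inner_eq_zero_iff order_antisym)

text \<open>
  The strict epigraph of \<open>h\<close> and the hypograph of \<open>- k\<close> over \<open>T\<close> are disjoint convex sets. A
  hyperplane separating them cannot be vertical, because \<open>h\<close> is finite everywhere, so it is the graph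
  of an affine function. The restriction of \<open>k\<close> to a set \<open>T\<close> lets a singleton \<open>T\<close> yield the existence
  of subgradients, and \<open>T = UNIV\<close> the sum rule.
\<close>

lemma convex_sandwich:
  fixes h k :: "'a::euclidean_space \<Rightarrow> real"
  assumes h: "convex_on UNIV h" and k: "convex_on T k" and ne: "T \<noteq> {}"
    and le: "\<And>y. y \<in> T \<Longrightarrow> - k y \<le> h y"
  shows "\<exists>a c. (\<forall>y. a \<bullet> y + c \<le> h y) \<and> (\<forall>y\<in>T. - k y \<le> a \<bullet> y + c)"
proof -
  let ?E = "{z :: 'a \<times> real. h (fst z) < snd z}"
  let ?H = "{z :: 'a \<times> real. fst z \<in> T \<and> snd z \<le> - k (fst z)}"
  have cE: "convex ?E"
  proof (rule convexI)
    fix z w :: "'a \<times> real" and u v :: real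
    assume z: "z \<in> ?E" and w: "w \<in> ?E" and uv: "0 \<le> u" "0 \<le> v" "u + v = 1"
    have "h (u *\<^sub>R fst z + v *\<^sub>R fst w) \<le> u * h (fst z) + v * h (fst w)"
      using h uv unfolding convex_on_def by blast
    also have "\<dots> < u * snd z + v * snd w"
    proof (cases "u = 0")
      case True
      with w uv show ?thesis by simp
    next
      case False
      with z w uv show ?thesis
        by (intro add_less_le_mono mult_strict_left_mono mult_left_mono) auto
    qed
    finally show "u *\<^sub>R z + v *\<^sub>R w \<in> ?E" by simp
  qed
  have cT: "convex T" using k by (simp add: convex_on_def)
  have cH: "convex ?H"
  proof (rule convexI)
    fix z w :: "'a \<times> real" and u v :: real
    assume z: "z \<in> ?H" and w: "w \<in> ?H" and uv: "0 \<le> u" "0 \<le> v" "u + v = 1"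
    have mem: "u *\<^sub>R fst z + v *\<^sub>R fst w \<in> T"
      using z w uv by (auto intro: convexD[OF cT])
    have "k (u *\<^sub>R fst z + v *\<^sub>R fst w) \<le> u * k (fst z) + v * k (fst w)"
      using k uv z w unfolding convex_on_def by blast
    also have "\<dots> \<le> u * (- snd z) + v * (- snd w)"
      using z w uv by (intro add_mono mult_left_mono) auto
    finally show "u *\<^sub>R z + v *\<^sub>R w \<in> ?H" using mem by simp
  qed
  have "(0, h 0 + 1) \<in> ?E" by simp
  then have "?E \<noteq> {}" by blast
  moreover obtain t0 where t0: "t0 \<in> T" using ne by blast
  then have "(t0, - k t0) \<in> ?H" by simp
  then have "?H \<noteq> {}" by blast
  moreover have "?H \<inter> ?E = {}" using le by force
  ultimately obtain p b where nz: "p \<noteq> 0"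
    and H: "\<forall>z\<in>?H. p \<bullet> z \<le> b" and E: "\<forall>z\<in>?E. b \<le> p \<bullet> z"
    using separating_hyperplane_sets[OF cH cE] by blast
  obtain q s where p: "p = (q, s)" by (cases p)
  have E': "b \<le> q \<bullet> y + s * r" if "h y < r" for y r
    using E[rule_format, of "(y, r)"] that by (simp add: p)
  have H': "q \<bullet> y - s * k y \<le> b" if "y \<in> T" for y
    using H[rule_format, of "(y, - k y)"] that by (simp add: p)
  have Hd: "q \<bullet> t0 + s * r \<le> b" if "r \<le> - k t0" for r
    using H[rule_format, of "(t0, r)"] that t0 by (simp add: p)
  \<comment> \<open>above \<open>t0\<close> lie points of both sets, those of the epigraph on top\<close>
  have s_nonneg: "0 \<le> s"
  proof (rule ccontr)
    assume "\<not> 0 \<le> s"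
    then have "s * (\<bar>h t0\<bar> + 1) < s * (- \<bar>k t0\<bar>)"
      by (intro mult_strict_left_mono_neg) auto
    moreover have "b \<le> q \<bullet> t0 + s * (\<bar>h t0\<bar> + 1)" by (rule E') linarith
    moreover have "q \<bullet> t0 + s * (- \<bar>k t0\<bar>) \<le> b" by (rule Hd) linarith
    ultimately show False by linarith
  qed
  have "s \<noteq> 0"
  proof
    assume s0: "s = 0"
    have lb: "b \<le> q \<bullet> y" for y using E'[of y "h y + 1"] s0 by simp
    have "q \<bullet> t0 \<le> b" using H'[OF t0] s0 by simp
    moreover have "b \<le> q \<bullet> (t0 - q)" by (rule lb)
    ultimately have "q \<bullet> q \<le> 0" by (simp add: inner_diff_right)
    then have "q = 0" by (rule inner_self_nonpos)
    with s0 p nz show False by (simp add: zero_prod_def)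
  qed
  with s_nonneg have s: "0 < s" by simp
  have Ele: "b \<le> q \<bullet> y + s * h y" for y
  proof (rule field_le_epsilon)
    fix e :: real assume e: "0 < e"
    have "b \<le> q \<bullet> y + s * (h y + e / s)" by (rule E') (use e s in simp)
    then show "b \<le> q \<bullet> y + s * h y + e" using s by (simp add: distrib_left)
  qed
  have "((- 1 / s) *\<^sub>R q) \<bullet> y + b / s \<le> h y" for y
    using Ele[of y] s by (simp add: field_simps)
  moreover have "- k y \<le> ((- 1 / s) *\<^sub>R q) \<bullet> y + b / s" if "y \<in> T" for y
    using H'[OF that] s by (simp add: field_simps)
  ultimately show ?thesis by blast
qed

lemma subgradients_nonempty:
  fixes h :: "'a::euclidean_space \<Rightarrow> real"
  assumes "convex_on UNIV h"
  shows "subgradients h x \<noteq> {}"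
proof -
  have "convex_on {x} (\<lambda>_. - h x)" by (simp add: convex_on_const)
  then obtain a c where a: "\<And>y. a \<bullet> y + c \<le> h y" "h x \<le> a \<bullet> x + c"
    using convex_sandwich[OF assms, of "{x}" "\<lambda>_. - h x"] by auto
  have "h x + a \<bullet> (y - x) \<le> h y" for y
    using a(1)[of y] a(1)[of x] a(2) by (simp add: inner_diff_right)
  then show ?thesis by (auto simp: subgradients_def)
qed

text \<open>
  If \<open>w\<close> is a subgradient of \<open>h + k\<close>, then \<open>h\<close> lies above the concave function
  \<open>y \<mapsto> w \<bullet> y - k y\<close>, up to a constant for which the two touch at \<open>x\<close>. An affine function between
  them therefore passes through the touching point, and its slope is the share of \<open>h\<close> in \<open>w\<close>.
\<close>

lemma subgradients_add:
  fixes h k :: "'a::euclidean_space \<Rightarrow> real"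
  assumes h: "convex_on UNIV h" and k: "convex_on UNIV k"
    and w: "w \<in> subgradients (\<lambda>y. h y + k y) x"
  obtains a where "a \<in> subgradients h x" "w - a \<in> subgradients k x"
proof -
  define K where "K y = k y + ((- w) \<bullet> y + (w \<bullet> x - h x - k x))" for y
  have "convex_on UNIV (\<lambda>y. (- w) \<bullet> y)"
    by (simp add: convex_on_def inner_add_right)
  then have "convex_on UNIV (\<lambda>y. (- w) \<bullet> y + (w \<bullet> x - h x - k x))"
    by (rule convex_on_add) (simp add: convex_on_const)
  then have "convex_on UNIV K"
    unfolding K_def by (rule convex_on_add[OF k])
  moreover have "- K y \<le> h y" for y
    using w unfolding subgradients_def K_def by (auto simp: inner_diff_right algebra_simps)
  ultimately obtain a c where a: "\<And>y. a \<bullet> y + c \<le> h y" "\<And>y. - K y \<le> a \<bullet> y + c"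
    using convex_sandwich[OF h, of UNIV K] by auto
  have touch: "a \<bullet> x + c = h x"
    using a(1)[of x] a(2)[of x] by (simp add: K_def)
  have "h x + a \<bullet> (y - x) \<le> h y" for y
    using a(1)[of y] touch by (simp add: inner_diff_right)
  moreover have "k x + (w - a) \<bullet> (y - x) \<le> k y" for y
    using a(2)[of y] touch by (simp add: K_def inner_diff_right inner_diff_left)
  ultimately show ?thesis
    by (intro that[of a]) (auto simp: subgradients_def)
qed

lemma subgradients_scale:
  fixes h :: "'a::euclidean_space \<Rightarrow> real"
  assumes h: "convex_on UNIV h" and c: "0 \<le> c"
    and a: "a \<in> subgradients (\<lambda>y. c * h y) x"
  obtains u where "u \<in> subgradients h x" "a = c *\<^sub>R u"
proof (cases "c = 0")
  case True
  have "a \<bullet> (x + a - x) \<le> 0"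
    using a True unfolding subgradients_def by (auto dest: spec[of _ "x + a"])
  then have "a = 0" by (simp add: inner_self_nonpos)
  with True subgradients_nonempty[OF h, of x] that show ?thesis by fastforce
next
  case False
  with c have c: "0 < c" by simp
  have "h x + (inverse c *\<^sub>R a) \<bullet> (y - x) \<le> h y" for y
  proof -
    have "c * h x + a \<bullet> (y - x) \<le> c * h y" using a by (simp add: subgradients_def)
    then show ?thesis using c by (simp add: field_simps)
  qed
  then show ?thesis
    using c by (intro that[of "inverse c *\<^sub>R a"]) (auto simp: subgradients_def)
qed

lemma convex_on_weighted_sum:
  fixes h :: "'j \<Rightarrow> 'a::real_vector \<Rightarrow> real"
  assumes "finite I" "\<And>j. j \<in> I \<Longrightarrow> convex_on UNIV (h j)" "\<And>j. j \<in> I \<Longrightarrow> 0 \<le> c j"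
  shows "convex_on UNIV (\<lambda>y. \<Sum>j\<in>I. c j * h j y)"
  using assms
proof (induction I rule: finite_induct)
  case empty
  then show ?case by (simp add: convex_on_const)
next
  case (insert i I)
  then show ?case by (auto intro!: convex_on_add convex_on_cmul)
qed

text \<open>
  Zero weights are allowed, and still a subgradient is delivered for every summand: this is where
  the existence of subgradients enters, through \<open>subgradients_scale\<close>.
\<close>

lemma subgradients_weighted_sum:
  fixes h :: "'j \<Rightarrow> 'a::euclidean_space \<Rightarrow> real"
  assumes "finite I" "\<And>j. j \<in> I \<Longrightarrow> convex_on UNIV (h j)" "\<And>j. j \<in> I \<Longrightarrow> 0 \<le> c j"
    and "w \<in> subgradients (\<lambda>y. \<Sum>j\<in>I. c j * h j y) x"
  shows "\<exists>u. (\<forall>j\<in>I. u j \<in> subgradients (h j) x) \<and> (\<Sum>j\<in>I. c j *\<^sub>R u j) = w"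
  using assms
proof (induction I arbitrary: w rule: finite_induct)
  case empty
  have "w \<bullet> (x + w - x) \<le> 0"
    using empty.prems unfolding subgradients_def by (auto dest: spec[of _ "x + w"])
  then show ?case by (simp add: inner_self_nonpos)
next
  case (insert i I)
  have hi: "convex_on UNIV (h i)" and ci: "0 \<le> c i" using insert.prems by auto
  have sub: "w \<in> subgradients (\<lambda>y. c i * h i y + (\<Sum>j\<in>I. c j * h j y)) x"
    using insert.prems insert.hyps by simp
  have "convex_on UNIV (\<lambda>y. c i * h i y)" using hi ci by (rule convex_on_cmul[rotated])
  moreover have "convex_on UNIV (\<lambda>y. \<Sum>j\<in>I. c j * h j y)"
    using insert.prems insert.hyps by (intro convex_on_weighted_sum) auto
  ultimately obtain a where a: "a \<in> subgradients (\<lambda>y. c i * h i y) x"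
    and rest: "w - a \<in> subgradients (\<lambda>y. \<Sum>j\<in>I. c j * h j y) x"
    using sub by (rule subgradients_add)
  obtain v where v: "v \<in> subgradients (h i) x" "a = c i *\<^sub>R v"
    using subgradients_scale[OF hi ci a] by blast
  obtain u where u: "\<forall>j\<in>I. u j \<in> subgradients (h j) x" "(\<Sum>j\<in>I. c j *\<^sub>R u j) = w - a"
    using insert.IH[OF _ _ rest] insert.prems by auto
  have "(\<Sum>j\<in>I. c j *\<^sub>R (u(i := v)) j) = w - a"
    unfolding u(2)[symmetric] using insert.hyps by (intro sum.cong) auto
  then show ?case
    using u v insert.hyps by (intro exI[of _ "u(i := v)"]) auto
qed

section \<open>Unsolvable systems of convex inequalities\<close>

text \<open>
  The set of vectors \<open>z\<close> that dominate \<open>(h j y)\<^sub>j\<close> strictly for some \<open>y\<close> is convex, and unsolvability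
  says that it misses the origin. The normal of a separating hyperplane has nonnegative
  entries because the set is closed under increasing any coordinate.
\<close>

lemma convex_alternative:
  fixes h :: "'j::finite \<Rightarrow> 'a::real_vector \<Rightarrow> real"
  assumes cvx: "\<And>j. convex_on UNIV (h j)"
    and unsolvable: "\<And>y. \<exists>j. 0 \<le> h j y"
  obtains c where "\<And>j. 0 \<le> c j" "\<exists>j. c j \<noteq> 0" "\<And>y. 0 \<le> (\<Sum>j\<in>UNIV. c j * h j y)"
proof -
  define S where "S = {z :: real ^ 'j. \<exists>y. \<forall>j. h j y < z $ j}"
  have "convex S"
  proof (rule convexI)
    fix z w :: "real ^ 'j" and u v :: real
    assume z: "z \<in> S" and w: "w \<in> S" and uv: "0 \<le> u" "0 \<le> v" "u + v = 1"
    obtain p q where p: "\<And>j. h j p < z $ j" and q: "\<And>j. h j q < w $ j"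
      using z w unfolding S_def by blast
    have "h j (u *\<^sub>R p + v *\<^sub>R q) < (u *\<^sub>R z + v *\<^sub>R w) $ j" for j
    proof -
      have "h j (u *\<^sub>R p + v *\<^sub>R q) \<le> u * h j p + v * h j q"
        using cvx[of j] uv unfolding convex_on_def by blast
      also have "\<dots> < u * z $ j + v * w $ j"
      proof (cases "u = 0")
        case True
        with q[of j] uv show ?thesis by simp
      next
        case False
        with p[of j] q[of j] uv show ?thesis
          by (intro add_less_le_mono mult_strict_left_mono mult_left_mono) auto
      qed
      finally show ?thesis by simp
    qed
    then show "u *\<^sub>R z + v *\<^sub>R w \<in> S" unfolding S_def by blast
  qed
  moreover have "0 \<notin> S"
  proof
    assume "0 \<in> S"
    then obtain y where y: "\<And>j. h j y < 0" unfolding S_def by auto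
    show False using unsolvable[of y] y by (meson not_less)
  qed
  ultimately obtain a where a: "a \<noteq> 0" "\<And>z. z \<in> S \<Longrightarrow> 0 \<le> a \<bullet> z"
    using separating_hyperplane_set_0[of S] by blast
  have lin: "0 \<le> (\<Sum>j\<in>UNIV. a $ j * (h j y + e j))" if "\<And>j. 0 < e j" for y e
  proof -
    have "(\<chi> j. h j y + e j) \<in> S" using that unfolding S_def by (auto intro!: exI[of _ y])
    from a(2)[OF this] show ?thesis by (simp add: inner_vec_def)
  qed
  \<comment> \<open>\<open>(h j y)\<^sub>j\<close> is only a limit of points of \<open>S\<close>, hence the small uniform shift \<open>e / A\<close>\<close>
  have nonneg: "0 \<le> (\<Sum>j\<in>UNIV. a $ j * h j y)" for y
  proof (rule field_le_epsilon)
    fix e :: real assume e: "0 < e"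
    define A where "A = \<bar>\<Sum>j\<in>UNIV. a $ j\<bar> + 1"
    have A: "0 < A" unfolding A_def by simp
    have "0 \<le> (\<Sum>j\<in>UNIV. a $ j * (h j y + e / A))" by (rule lin) (use e A in simp)
    also have "\<dots> = (\<Sum>j\<in>UNIV. a $ j * h j y) + (\<Sum>j\<in>UNIV. a $ j) * (e / A)"
      by (simp add: distrib_left sum.distrib sum_distrib_right sum_divide_distrib)
    also have "(\<Sum>j\<in>UNIV. a $ j) * (e / A) \<le> A * (e / A)"
      using e A by (intro mult_right_mono) (auto simp: A_def)
    also have "A * (e / A) = e" using A by simp
    finally show "0 \<le> (\<Sum>j\<in>UNIV. a $ j * h j y) + e" by simp
  qed
  have coord: "0 \<le> a $ i" for i
  proof (rule ccontr)
    assume "\<not> 0 \<le> a $ i"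
    then have neg: "a $ i < 0" by simp
    define B where "B = (\<Sum>j\<in>UNIV. a $ j * (h j 0 + 1))"
    \<comment> \<open>raising coordinate \<open>i\<close> by this amount outweighs all other terms\<close>
    define s where "s = (\<bar>B\<bar> + 1) / (- a $ i)"
    have s: "0 < s" using neg unfolding s_def by (intro divide_pos_pos) auto
    have "0 \<le> (\<Sum>j\<in>UNIV. a $ j * (h j 0 + (1 + (if j = i then s else 0))))"
      by (rule lin) (use s in auto)
    also have "\<dots> = B + (\<Sum>j\<in>UNIV. if j = i then a $ i * s else 0)"
      unfolding B_def sum.distrib[symmetric] by (intro sum.cong) (auto simp: algebra_simps)
    also have "\<dots> = B + a $ i * s" by simp
    also have "a $ i * s = - (\<bar>B\<bar> + 1)" using neg by (simp add: s_def field_simps)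
    finally show False by linarith
  qed
  have "\<exists>j. a $ j \<noteq> 0" using a(1) by (metis vec_eq_iff zero_index)
  then show ?thesis using that[of "\<lambda>j. a $ j"] coord nonneg by blast
qed

section \<open>The Clarke directional derivative\<close>

abbreviation clarke_filter :: "'a::real_normed_vector \<Rightarrow> ('a \<times> real) filter" where
  "clarke_filter x \<equiv> nhds x \<times>\<^sub>F at_right 0"

lemma clarke_dderiv_less_imp_quotient_less:
  assumes "clarke_dderiv h x d < C"
  shows "\<forall>\<^sub>F t in at_right 0. ereal ((h (x + t *\<^sub>R d) - h x) / t) < C"
proof -
  have "\<forall>\<^sub>F z in clarke_filter x. (case z of (y, t) \<Rightarrow> ereal ((h (y + t *\<^sub>R d) - h y) / t)) < C"
    using assms unfolding clarke_dderiv_def by (rule Limsup_lessD)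
  moreover have "filterlim (\<lambda>t. (x, t)) (clarke_filter x) (at_right 0)"
    by (intro filterlim_Pair filterlim_ident tendsto_const)
  ultimately show ?thesis
    by (auto dest: eventually_compose_filterlim)
qed

text \<open>
  If the upper limit were smaller than \<open>v \<bullet> d\<close>, so would be the quotients with fixed base point \<open>x\<close>,
  which the subgradient inequality forbids.
\<close>

lemma subgradients_subset_clarke: "subgradients h x \<subseteq> clarke_subdiff h x"
proof
  fix v assume v: "v \<in> subgradients h x"
  have "ereal (v \<bullet> d) \<le> clarke_dderiv h x d" for d
  proof (rule ccontr)
    assume "\<not> ?thesis"
    then have "\<forall>\<^sub>F t in at_right 0. ereal ((h (x + t *\<^sub>R d) - h x) / t) < ereal (v \<bullet> d)"
      by (intro clarke_dderiv_less_imp_quotient_less) simp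
    moreover have "\<forall>\<^sub>F t :: real in at_right 0. 0 < t" by (rule eventually_at_right_less)
    ultimately have "\<forall>\<^sub>F t :: real in at_right 0. False"
    proof eventually_elim
      case (elim t)
      have "h x + v \<bullet> (x + t *\<^sub>R d - x) \<le> h (x + t *\<^sub>R d)"
        using v by (simp only: subgradients_def mem_Collect_eq)
      with elim show ?case by (simp add: field_simps)
    qed
    then show False by simp
  qed
  then show "v \<in> clarke_subdiff h x" by (simp add: clarke_subdiff_def)
qed

lemma clarke_filter_snd_tendsto: "(snd \<longlongrightarrow> 0) (clarke_filter x)"
  and clarke_filter_snd_pos: "\<forall>\<^sub>F z in clarke_filter x. 0 < snd z"
  using filterlim_snd[of "at_right (0::real)" "nhds x"]
  by (auto simp: filterlim_at elim: eventually_mono)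

lemma clarke_filter_neq_bot: "clarke_filter x \<noteq> bot"
  by (simp add: prod_filter_eq_bot)

lemma clarke_dderiv_finite:
  fixes h :: "'a::real_normed_vector \<Rightarrow> real"
  assumes "locally_lipschitz h"
  shows "\<bar>clarke_dderiv h x d\<bar> \<noteq> \<infinity>"
proof -
  obtain u L where u: "0 < u" and L: "L-lipschitz_on (cball x u) h"
    using assms unfolding locally_lipschitz_def local_lipschitz_def
    by (metis UNIV_I Int_UNIV_right centre_in_cball less_imp_le)
  have mv: "((\<lambda>z. fst z + snd z *\<^sub>R d) \<longlongrightarrow> x) (clarke_filter x)"
    using tendsto_add[OF filterlim_fst tendsto_scaleR[OF clarke_filter_snd_tendsto tendsto_const[of d]]] by simp
  have ball: "\<forall>\<^sub>F y in nhds x. y \<in> cball x u"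
    using eventually_nhds_in_open[of "ball x u" x] u by (auto elim!: eventually_mono)
  have "\<forall>\<^sub>F z in clarke_filter x. fst z \<in> cball x u"
    using eventually_compose_filterlim[OF ball filterlim_fst] .
  moreover have "\<forall>\<^sub>F z in clarke_filter x. fst z + snd z *\<^sub>R d \<in> cball x u"
    using eventually_compose_filterlim[OF ball mv] .
  moreover have "\<forall>\<^sub>F z in clarke_filter x. 0 < snd z"
    by (rule clarke_filter_snd_pos)
  ultimately have bound: "\<forall>\<^sub>F z in clarke_filter x.
      \<bar>(h (fst z + snd z *\<^sub>R d) - h (fst z)) / snd z\<bar> \<le> L * norm d"
  proof eventually_elim
    case (elim z)
    have "\<bar>h (fst z + snd z *\<^sub>R d) - h (fst z)\<bar> \<le> L * (snd z * norm d)"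
      using lipschitz_onD[OF L elim(2) elim(1)] elim(3) by (simp add: dist_norm)
    with elim(3) show ?case by (simp add: abs_divide field_simps)
  qed
  have "clarke_dderiv h x d \<le> ereal (L * norm d)"
    unfolding clarke_dderiv_def
    by (rule Limsup_bounded) (use bound in eventually_elim, auto simp: case_prod_beta abs_le_iff simp del: abs_divide)
  moreover have "ereal (- (L * norm d)) \<le> clarke_dderiv h x d"
    unfolding clarke_dderiv_def
    by (rule order_trans[OF Liminf_bounded Liminf_le_Limsup[OF clarke_filter_neq_bot]])
      (use bound in eventually_elim, auto simp: case_prod_beta abs_le_iff simp del: abs_divide)
  ultimately show ?thesis by (cases "clarke_dderiv h x d") auto
qed

lemma clarke_dderiv_zero: "clarke_dderiv h x 0 = 0"
  using Limsup_const[OF clarke_filter_neq_bot, of x "0::ereal"]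
  by (simp add: clarke_dderiv_def split_def flip: zero_ereal_def)

text \<open>
  With \<open>0 < u\<close>, \<open>0 < v\<close>, \<open>u + v = 1\<close>, the difference quotient in direction \<open>u d + v e\<close> is \<open>u\<close> times a
  quotient in direction \<open>d\<close> with base point \<open>y + t v e\<close> and step \<open>t u\<close>, plus \<open>v\<close> times a quotient in
  direction \<open>e\<close> with base point \<open>y\<close> and step \<open>t v\<close>. The displaced base point is harmless since the
  upper limit ranges over all base points near \<open>x\<close>; this is why the Clarke derivative is convex in
  its direction even when \<open>h\<close> is not.
\<close>

lemma clarke_dderiv_convex:
  fixes h :: "'a::real_normed_vector \<Rightarrow> real"
  assumes lip: "locally_lipschitz h"
  shows "convex_on UNIV (\<lambda>d. real_of_ereal (clarke_dderiv h x d))"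
proof (rule convex_onI)
  fix v :: real and d e :: 'a
  assume v: "0 < v" "v < 1"
  define u where "u = 1 - v"
  have u: "0 < u" using v by (simp add: u_def)
  let ?P = "\<lambda>d. real_of_ereal (clarke_dderiv h x d)"
  let ?q = "\<lambda>d (y, t). (h (y + t *\<^sub>R d) - h y) / t"
  have P: "ereal (?P d) = clarke_dderiv h x d" for d
    using clarke_dderiv_finite[OF lip] by (simp add: ereal_real)
  have ev: "\<forall>\<^sub>F z in clarke_filter x. ?q d z < ?P d + \<eta>" if "0 < \<eta>" for d \<eta>
  proof -
    have "ereal (?P d) < ereal (?P d + \<eta>)" using that by (simp only: less_ereal.simps less_add_same_cancel1)
    then have "clarke_dderiv h x d < ereal (?P d + \<eta>)" by (simp only: P)
    then have "\<forall>\<^sub>F z in clarke_filter x. (case z of (y, t) \<Rightarrow>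
        ereal ((h (y + t *\<^sub>R d) - h y) / t)) < ereal (?P d + \<eta>)"
      unfolding clarke_dderiv_def by (rule Limsup_lessD)
    then show ?thesis by eventually_elim (auto simp: case_prod_beta)
  qed
  have scaled: "filterlim (\<lambda>z. snd z * s) (at_right 0) (clarke_filter x)" if "0 < s" for s
    unfolding filterlim_at
    using tendsto_mult_left_zero[OF clarke_filter_snd_tendsto, of s x] clarke_filter_snd_pos[of x] that
    by (auto elim!: eventually_mono)
  have mv: "((\<lambda>z. fst z + (snd z * v) *\<^sub>R e) \<longlongrightarrow> x) (clarke_filter x)"
    using tendsto_add[OF filterlim_fst tendsto_scaleR[OF
        tendsto_mult_left_zero[OF clarke_filter_snd_tendsto] tendsto_const[of e]]]
    by simp
  have lim_d: "filterlim (\<lambda>z. (fst z + (snd z * v) *\<^sub>R e, snd z * u)) (clarke_filter x) (clarke_filter x)"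
    by (intro filterlim_Pair mv scaled u)
  have lim_e: "filterlim (\<lambda>z. (fst z, snd z * v)) (clarke_filter x) (clarke_filter x)"
    by (intro filterlim_Pair filterlim_fst scaled v)
  have "?P (u *\<^sub>R d + v *\<^sub>R e) \<le> u * ?P d + v * ?P e"
  proof (rule field_le_epsilon)
    fix \<eta> :: real assume \<eta>: "0 < \<eta>"
    have "\<forall>\<^sub>F z in clarke_filter x. ?q (u *\<^sub>R d + v *\<^sub>R e) z \<le> u * ?P d + v * ?P e + \<eta>"
      using eventually_compose_filterlim[OF ev[OF \<eta>, of d] lim_d]
        eventually_compose_filterlim[OF ev[OF \<eta>, of e] lim_e] clarke_filter_snd_pos[of x]
    proof eventually_elim
      case (elim z)
      obtain y t where z: "z = (y, t)" by (cases z)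
      have t: "0 < t" using elim(3) z by simp
      let ?w = "y + (t * v) *\<^sub>R e"
      have "?q (u *\<^sub>R d + v *\<^sub>R e) z
          = u * ((h (?w + (t * u) *\<^sub>R d) - h ?w) / (t * u)) + v * ((h ?w - h y) / (t * v))"
        using t u v(1) by (simp add: z field_simps scaleR_add_right)
      also have "\<dots> \<le> u * (?P d + \<eta>) + v * (?P e + \<eta>)"
        using elim(1,2) u v(1) unfolding z by (intro add_mono mult_left_mono) auto
      also have "\<dots> = u * ?P d + v * ?P e + \<eta>" by (simp add: u_def algebra_simps)
      finally show ?case .
    qed
    then have "clarke_dderiv h x (u *\<^sub>R d + v *\<^sub>R e) \<le> ereal (u * ?P d + v * ?P e + \<eta>)"
      unfolding clarke_dderiv_def
      by (intro Limsup_bounded) (auto simp: case_prod_beta elim!: eventually_mono)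
    then have "ereal (?P (u *\<^sub>R d + v *\<^sub>R e)) \<le> ereal (u * ?P d + v * ?P e + \<eta>)"
      by (simp only: P)
    then show "?P (u *\<^sub>R d + v *\<^sub>R e) \<le> u * ?P d + v * ?P e + \<eta>"
      by (simp only: ereal_less_eq)
  qed
  then show "?P ((1 - v) *\<^sub>R d + v *\<^sub>R e) \<le> (1 - v) * ?P d + v * ?P e"
    by (simp add: u_def)
qed simp

text \<open>
  The Clarke derivative as a function of the end point \<open>y = x + d\<close>: in this form it can be added to
  constraint functions, and its subgradients at \<open>x\<close> are Clarke subgradients of \<open>h\<close> at \<open>x\<close>.
\<close>

definition clarke_model :: "('a::real_normed_vector \<Rightarrow> real) \<Rightarrow> 'a \<Rightarrow> 'a \<Rightarrow> real" where
  "clarke_model h x y = real_of_ereal (clarke_dderiv h x (y - x))"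

lemma clarke_model_convex:
  assumes "locally_lipschitz h"
  shows "convex_on UNIV (clarke_model h x)"
proof (rule convex_onI)
  fix t :: real and y z :: 'a
  assume "0 < t" "t < 1"
  then have "real_of_ereal (clarke_dderiv h x ((1 - t) *\<^sub>R (y - x) + t *\<^sub>R (z - x)))
      \<le> (1 - t) * clarke_model h x y + t * clarke_model h x z"
    using convex_onD[OF clarke_dderiv_convex[OF assms, of x], of t "y - x" "z - x"]
    by (simp add: clarke_model_def)
  moreover have "(1 - t) *\<^sub>R (y - x) + t *\<^sub>R (z - x) = ((1 - t) *\<^sub>R y + t *\<^sub>R z) - x"
    by (simp add: algebra_simps)
  ultimately show "clarke_model h x ((1 - t) *\<^sub>R y + t *\<^sub>R z)
      \<le> (1 - t) * clarke_model h x y + t * clarke_model h x z"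
    by (simp add: clarke_model_def)
qed simp

lemma clarke_model_base: "clarke_model h x x = 0"
  by (simp add: clarke_model_def clarke_dderiv_zero)

lemma subgradient_clarke_model:
  assumes lip: "locally_lipschitz h" and v: "v \<in> subgradients (clarke_model h x) x"
  shows "v \<in> clarke_subdiff h x"
proof -
  have "ereal (v \<bullet> d) \<le> clarke_dderiv h x d" for d
  proof -
    have "clarke_model h x x + v \<bullet> (x + d - x) \<le> clarke_model h x (x + d)"
      using v by (simp only: subgradients_def mem_Collect_eq)
    then have "v \<bullet> d \<le> real_of_ereal (clarke_dderiv h x d)"
      by (simp add: clarke_model_base) (simp add: clarke_model_def)
    then show ?thesis
      using clarke_dderiv_finite[OF lip, of x d] by (cases "clarke_dderiv h x d") auto
  qed
  then show ?thesis by (simp add: clarke_subdiff_def)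
qed

lemma clarke_model_neg_imp_descent:
  assumes lip: "locally_lipschitz h" and neg: "clarke_model h x y < 0"
  shows "\<forall>\<^sub>F t in at_right 0. h (x + t *\<^sub>R (y - x)) < h x"
proof -
  have "clarke_dderiv h x (y - x) < 0"
    using neg clarke_dderiv_finite[OF lip, of x "y - x"]
    by (cases "clarke_dderiv h x (y - x)") (auto simp: clarke_model_def)
  then have "\<forall>\<^sub>F t in at_right 0. ereal ((h (x + t *\<^sub>R (y - x)) - h x) / t) < 0"
    by (rule clarke_dderiv_less_imp_quotient_less)
  moreover have "\<forall>\<^sub>F t :: real in at_right 0. 0 < t" by (rule eventually_at_right_less)
  ultimately show ?thesis
    by eventually_elim (simp add: divide_less_0_iff flip: zero_ereal_def)
qed

section \<open>Optimality conditions\<close>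

lemma positive_in_interior_nonneg_orthant:
  fixes z :: "real ^ 'p"
  assumes "\<And>i. 0 < z $ i"
  shows "z \<in> interior nonneg_orthant"
proof (rule interiorI)
  have "{z :: real ^ 'p. \<forall>i. 0 < z $ i} = (\<Inter>i. {z. z $ i > 0})" by auto
  then show "open {z :: real ^ 'p. \<forall>i. 0 < z $ i}"
    using open_halfspace_component_gt_cart by (auto intro!: open_INT)
qed (use assms in \<open>auto simp: nonneg_orthant_def less_imp_le\<close>)

lemma local_weak_pareto_min_obtains:
  fixes f :: "'m::finite \<Rightarrow> 'a::metric_space \<Rightarrow> real"
  assumes "local_weak_pareto_min f X x0"
  obtains \<delta> where "0 < \<delta>" "\<And>x. x \<in> X \<Longrightarrow> x \<in> ball x0 \<delta> \<Longrightarrow> \<exists>i. f i x0 \<le> f i x"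
proof -
  have dominated: "(\<chi> i. f i x) - (\<chi> i. f i x0) \<in> uminus ` interior nonneg_orthant"
    if "\<And>i. f i x < f i x0" for x
  proof (rule image_eqI)
    show "(\<chi> i. f i x0) - (\<chi> i. f i x) \<in> interior nonneg_orthant"
      by (rule positive_in_interior_nonneg_orthant) (simp add: that)
  qed simp
  from assms obtain \<delta> where "0 < \<delta>"
    "\<And>x. x \<in> X \<Longrightarrow> x \<in> ball x0 \<delta> \<Longrightarrow>
      (\<chi> i. f i x) - (\<chi> i. f i x0) \<notin> uminus ` interior nonneg_orthant"
    unfolding local_weak_pareto_min_def by blast
  then show ?thesis using dominated that by (meson not_less)
qed

text \<open>
  The constraints enter with their values at \<open>y\<close>, not with their directional derivatives, and whether
  or not they are active at \<open>x0\<close>: convexity alone makes every point strictly between \<open>x0\<close> and \<open>y\<close>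
  feasible.
\<close>

lemma pareto_min_system_unsolvable:
  fixes f :: "'m::finite \<Rightarrow> 'a::real_normed_vector \<Rightarrow> real"
  assumes lip: "\<And>i. locally_lipschitz (f i)"
    and cvx: "\<And>r. convex_on UNIV (g r)"
    and min: "local_weak_pareto_min f (feasible_set g) x0"
  shows "\<not> ((\<forall>i. clarke_model (f i) x0 y < 0) \<and> (\<forall>r. g r y < 0))"
proof
  assume "(\<forall>i. clarke_model (f i) x0 y < 0) \<and> (\<forall>r. g r y < 0)"
  then have neg: "\<And>i. clarke_model (f i) x0 y < 0" and gneg: "\<And>r. g r y < 0" by auto
  have x0: "x0 \<in> feasible_set g" using min by (simp add: local_weak_pareto_min_def)
  obtain \<delta> where \<delta>: "0 < \<delta>"
    and opt: "\<And>x. x \<in> feasible_set g \<Longrightarrow> x \<in> ball x0 \<delta> \<Longrightarrow> \<exists>i. f i x0 \<le> f i x"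
    using local_weak_pareto_min_obtains[OF min] by blast
  have "((\<lambda>t. x0 + t *\<^sub>R (y - x0)) \<longlongrightarrow> x0 + 0 *\<^sub>R (y - x0)) (at_right (0::real))"
    by (intro tendsto_intros)
  then have "\<forall>\<^sub>F t in at_right (0::real). x0 + t *\<^sub>R (y - x0) \<in> ball x0 \<delta>"
    using topological_tendstoD[of _ x0 _ "ball x0 \<delta>"] \<delta> by simp
  moreover have "\<forall>\<^sub>F t in at_right (0::real). t \<in> {0<..<1}"
    by (rule eventually_at_right_real) simp
  moreover have "\<forall>\<^sub>F t in at_right 0. \<forall>i. f i (x0 + t *\<^sub>R (y - x0)) < f i x0"
    by (rule eventually_all_finite) (rule clarke_model_neg_imp_descent[OF lip neg])
  ultimately have "\<forall>\<^sub>F t in at_right (0::real). False"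
  proof eventually_elim
    case (elim t)
    have eq: "x0 + t *\<^sub>R (y - x0) = (1 - t) *\<^sub>R x0 + t *\<^sub>R y" by (simp add: algebra_simps)
    have "g r (x0 + t *\<^sub>R (y - x0)) \<le> 0" for r
    proof -
      have "g r (x0 + t *\<^sub>R (y - x0)) \<le> (1 - t) * g r x0 + t * g r y"
        unfolding eq using elim(2) by (intro convex_onD[OF cvx]) auto
      also have "\<dots> \<le> 0"
        using elim(2) x0 gneg[of r]
        by (intro add_nonpos_nonpos mult_nonneg_nonpos) (auto simp: feasible_set_def less_imp_le)
      finally show ?thesis .
    qed
    then have "x0 + t *\<^sub>R (y - x0) \<in> feasible_set g" by (simp add: feasible_set_def)
    then show ?case using opt elim(1,3) by (meson not_less)
  qed
  then show False by simp
qed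

lemma sum_UNIV_Plus:
  fixes F :: "'m::finite + 'l::finite \<Rightarrow> 'b::comm_monoid_add"
  shows "(\<Sum>j\<in>UNIV. F j) = (\<Sum>i\<in>UNIV. F (Inl i)) + (\<Sum>r\<in>UNIV. F (Inr r))"
  unfolding UNIV_Plus_UNIV[symmetric] by (subst sum.Plus) auto

text \<open>
  The objectives' Clarke models and the constraints are treated as one family of convex functions,
  indexed by the sum type, so that one use of the alternative and one of the sum rule serve both.
\<close>

lemma pareto_min_multiplier_rule:
  fixes f :: "'m::finite \<Rightarrow> 'a::euclidean_space \<Rightarrow> real" and g :: "'l::finite \<Rightarrow> 'a \<Rightarrow> real"
  assumes lip: "\<And>i. locally_lipschitz (f i)"
    and cvx: "\<And>r. convex_on UNIV (g r)"
    and slater: "slater_cq g"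
    and min: "local_weak_pareto_min f (feasible_set g) x0"
  obtains u v and lam :: "real ^ 'm" and \<mu> :: "real ^ 'l"
  where "\<And>i. u i \<in> clarke_subdiff (f i) x0" "\<And>r. v r \<in> clarke_subdiff (g r) x0"
    "lam \<in> nonneg_orthant" "norm lam = 1" "\<mu> \<in> nonneg_orthant"
    "(\<Sum>i\<in>UNIV. lam $ i *\<^sub>R u i) + (\<Sum>r\<in>UNIV. \<mu> $ r *\<^sub>R v r) = 0"
    "(\<Sum>r\<in>UNIV. \<mu> $ r * g r x0) = 0"
proof -
  define h where "h = case_sum (\<lambda>i. clarke_model (f i) x0) g"
  have h_cvx: "convex_on UNIV (h j)" for j
    using clarke_model_convex[OF lip] cvx by (cases j) (auto simp: h_def)
  have "\<exists>j. 0 \<le> h j y" for y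
  proof (rule ccontr)
    assume "\<nexists>j. 0 \<le> h j y"
    then have neg: "h j y < 0" for j by (meson not_less)
    have "clarke_model (f i) x0 y < 0" for i using neg[of "Inl i"] by (simp add: h_def)
    moreover have "g r y < 0" for r using neg[of "Inr r"] by (simp add: h_def)
    ultimately show False using pareto_min_system_unsolvable[OF lip cvx min] by blast
  qed
  then obtain c where c: "\<And>j. 0 \<le> c j" "\<exists>j. c j \<noteq> 0" "\<And>y. 0 \<le> (\<Sum>j\<in>UNIV. c j * h j y)"
    using convex_alternative[of h] h_cvx by blast
  have x0: "g r x0 \<le> 0" for r
    using min by (auto simp: local_weak_pareto_min_def feasible_set_def)
  have "(\<Sum>j\<in>UNIV. c j * h j x0) = (\<Sum>r\<in>UNIV. c (Inr r) * g r x0)"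
    by (simp add: sum_UNIV_Plus h_def clarke_model_base)
  moreover have "(\<Sum>r\<in>UNIV. c (Inr r) * g r x0) \<le> 0"
    using c(1) x0 by (intro sum_nonpos mult_nonneg_nonpos) auto
  ultimately have sum0: "(\<Sum>j\<in>UNIV. c j * h j x0) = 0"
    and comp: "(\<Sum>r\<in>UNIV. c (Inr r) * g r x0) = 0"
    using c(3)[of x0] by linarith+
  have "0 \<in> subgradients (\<lambda>y. \<Sum>j\<in>UNIV. c j * h j y) x0"
    using c(3) by (simp add: subgradients_def sum0)
  then obtain w where w: "\<And>j. w j \<in> subgradients (h j) x0" "(\<Sum>j\<in>UNIV. c j *\<^sub>R w j) = 0"
    using subgradients_weighted_sum[of UNIV h c 0 x0] h_cvx c(1) by auto
  define lam :: "real ^ 'm" where "lam = (\<chi> i. c (Inl i))"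
  define \<mu> :: "real ^ 'l" where "\<mu> = (\<chi> r. c (Inr r))"
  have "lam \<noteq> 0"
  proof
    assume lam0: "lam = 0"
    have cl: "c (Inl i) = 0" for i
      using lam0 by (metis lam_def vec_lambda_beta zero_index)
    obtain xh where xh: "\<And>r. g r xh < 0" using slater by (auto simp: slater_cq_def)
    obtain r where r: "c (Inr r) \<noteq> 0" using c(2) cl by (metis sum.exhaust_sel)
    have "(\<Sum>j\<in>UNIV. c j * h j xh) = (\<Sum>r\<in>UNIV. c (Inr r) * g r xh)"
      by (simp add: sum_UNIV_Plus cl h_def)
    moreover have "(\<Sum>r\<in>UNIV. c (Inr r) * g r xh) < (\<Sum>r\<in>(UNIV :: 'l set). 0)"
    proof (rule sum_strict_mono_ex1)
      show "\<forall>r\<in>UNIV. c (Inr r) * g r xh \<le> 0"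
        using c(1) xh by (auto intro!: mult_nonneg_nonpos simp: less_imp_le)
      have "c (Inr r) * g r xh < 0"
        using c(1)[of "Inr r"] r xh[of r] by (intro mult_pos_neg) auto
      then show "\<exists>r\<in>UNIV. c (Inr r) * g r xh < 0" by blast
    qed simp
    ultimately show False using c(3)[of xh] by simp
  qed
  then have N: "0 < norm lam" by simp
  let ?s = "inverse (norm lam)"
  have "?s *\<^sub>R ((\<Sum>i\<in>UNIV. c (Inl i) *\<^sub>R w (Inl i)) + (\<Sum>r\<in>UNIV. c (Inr r) *\<^sub>R w (Inr r))) = 0"
    using w(2) by (simp add: sum_UNIV_Plus)
  then have eq: "(\<Sum>i\<in>UNIV. (?s *\<^sub>R lam) $ i *\<^sub>R w (Inl i)) + (\<Sum>r\<in>UNIV. (?s *\<^sub>R \<mu>) $ r *\<^sub>R w (Inr r)) = 0"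
    by (simp add: lam_def \<mu>_def scaleR_add_right scaleR_sum_right)
  have "?s * (\<Sum>r\<in>UNIV. c (Inr r) * g r x0) = 0" using comp by simp
  then have comp': "(\<Sum>r\<in>UNIV. (?s *\<^sub>R \<mu>) $ r * g r x0) = 0"
    by (simp add: \<mu>_def sum_distrib_left mult.assoc)
  show ?thesis
  proof (rule that[of "\<lambda>i. w (Inl i)" "\<lambda>r. w (Inr r)" "?s *\<^sub>R lam" "?s *\<^sub>R \<mu>"])
    show "w (Inl i) \<in> clarke_subdiff (f i) x0" for i
      using w(1)[of "Inl i"] by (intro subgradient_clarke_model lip) (simp add: h_def)
    show "w (Inr r) \<in> clarke_subdiff (g r) x0" for r
      using w(1)[of "Inr r"] subgradients_subset_clarke[of "g r" x0] by (auto simp: h_def)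
    show "?s *\<^sub>R lam \<in> nonneg_orthant" "?s *\<^sub>R \<mu> \<in> nonneg_orthant"
      using c(1) N by (auto simp: nonneg_orthant_def lam_def \<mu>_def)
    show "norm (?s *\<^sub>R lam) = 1" using N by simp
  qed (fact eq comp')+
qed

theorem theorem3p6:
  fixes f :: "'m::finite \<Rightarrow> real ^ 'n \<Rightarrow> real"
    and g :: "'l::finite \<Rightarrow> real ^ 'n \<Rightarrow> real"
    and x0 :: "real ^ 'n"
    and \<epsilon> :: "nat \<Rightarrow> real"
  assumes "\<And>i. locally_lipschitz (f i)"
    and "\<And>r. convex_on UNIV (g r)"
    and "slater_cq g"
    and "local_weak_pareto_min f (feasible_set g) x0"
    and "\<And>k. \<epsilon> k > 0"
    and "decseq \<epsilon>"
    and "\<epsilon> \<longlonglongrightarrow> 0"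
  shows "\<exists>x :: nat \<Rightarrow> real ^ 'n.
    (\<forall>k. x k \<in> feasible_set g) \<and> x \<longlonglongrightarrow> x0 \<and>
    (\<exists>y. (\<exists>\<sigma>. strict_mono \<sigma> \<and> y = x \<circ> \<sigma>) \<and>
      (\<forall>k. \<exists>yh.
        norm (y k - yh) \<le> sqrt (\<epsilon> k) \<and>
        (\<exists>(u :: 'm \<Rightarrow> real ^ 'n) (v :: 'l \<Rightarrow> real ^ 'n) (lam :: real ^ 'm) (\<mu> :: real ^ 'l).
          (\<forall>i. u i \<in> clarke_subdiff (f i) yh) \<and>
          (\<forall>r. v r \<in> clarke_subdiff (g r) yh) \<and>
          lam \<in> nonneg_orthant \<and> norm lam = 1 \<and>
          \<mu> \<in> nonneg_orthant \<and>
          norm ((\<Sum>i\<in>UNIV. lam $ i *\<^sub>R u i) + (\<Sum>r\<in>UNIV. \<mu> $ r *\<^sub>R v r)) \<le> sqrt (\<epsilon> k) \<and>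
          (\<Sum>r\<in>UNIV. \<mu> $ r * g r yh) = 0)))"
proof -
  obtain u v and lam :: "real ^ 'm" and \<mu> :: "real ^ 'l"
    where kkt: "\<And>i. u i \<in> clarke_subdiff (f i) x0" "\<And>r. v r \<in> clarke_subdiff (g r) x0"
      "lam \<in> nonneg_orthant" "norm lam = 1" "\<mu> \<in> nonneg_orthant"
      "(\<Sum>i\<in>UNIV. lam $ i *\<^sub>R u i) + (\<Sum>r\<in>UNIV. \<mu> $ r *\<^sub>R v r) = 0"
      "(\<Sum>r\<in>UNIV. \<mu> $ r * g r x0) = 0"
    using pareto_min_multiplier_rule[OF assms(1-4)] by blast
  have x0: "x0 \<in> feasible_set g" using assms(4) by (simp add: local_weak_pareto_min_def)
  have root: "0 \<le> sqrt (\<epsilon> k)" for k using assms(5)[of k] by simp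
  show ?thesis
  proof (intro exI[of _ "\<lambda>_. x0"] conjI allI)
    show "\<exists>\<sigma> :: nat \<Rightarrow> nat. strict_mono \<sigma> \<and> (\<lambda>_::nat. x0) = (\<lambda>_. x0) \<circ> \<sigma>"
      by (intro exI[of _ id]) (auto simp: strict_mono_def)
    fix k
    show "\<exists>yh. norm (x0 - yh) \<le> sqrt (\<epsilon> k) \<and>
        (\<exists>(u :: 'm \<Rightarrow> real ^ 'n) (v :: 'l \<Rightarrow> real ^ 'n) (lam :: real ^ 'm) (\<mu> :: real ^ 'l).
          (\<forall>i. u i \<in> clarke_subdiff (f i) yh) \<and>
          (\<forall>r. v r \<in> clarke_subdiff (g r) yh) \<and>
          lam \<in> nonneg_orthant \<and> norm lam = 1 \<and>
          \<mu> \<in> nonneg_orthant \<and>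
          norm ((\<Sum>i\<in>UNIV. lam $ i *\<^sub>R u i) + (\<Sum>r\<in>UNIV. \<mu> $ r *\<^sub>R v r)) \<le> sqrt (\<epsilon> k) \<and>
          (\<Sum>r\<in>UNIV. \<mu> $ r * g r yh) = 0)"
      using kkt root[of k]
      by (intro exI[of _ x0] conjI exI[of _ u] exI[of _ v] exI[of _ lam] exI[of _ \<mu>]) auto
  qed (use x0 in auto)
qed

end
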